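(* Let $\rho,\kappa,\delta>0$, $0<\alpha<1$ and $v_0,v_1\in\mathcal S(\mathbb R)$. Then for every given $t\ge0$ the function $\mathbb R\ni x\mapsto u(t,x)$, where $$u(t,x)=\int_{\mathbb R}e^{-i\xi x}\left[\widehat{v_0}(\xi)\cos(\omega(\xi)t)+\frac{\widehat{v_1}(\xi)}{\omega(\xi)}\sin(\omega(\xi)t)\right]d\xi,$$ belongs to the Schwartz space $\mathcal S(\mathbb R)$.
   Context: $\omega(\xi)=\left(\frac{2\kappa}{\rho\,\delta^{2\alpha}}\int_{-1}^{1}\frac{1-\cos(\xi\delta z)}{|z|^{1+2\alpha}}\,dz\right)^{1/2}$ for $\xi\in\mathbb R$. The Fourier transform is $\widehat v(\xi):=\frac1{2\pi}\int_{\mathbb R}v(x)e^{ix\xi}\,dx$. At $\xi=0$ (where $\omega=0$) the quotient $\sin(\omega(\xi)t)/\omega(\xi)$ is understood as $t$. *)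

theory Defs
  imports "HOL-Analysis.Analysis"
begin

definition nth_vector_derivative :: "nat \<Rightarrow> (real \<Rightarrow> complex) \<Rightarrow> real \<Rightarrow> complex" where
  "nth_vector_derivative n = (\<lambda>f x. vector_derivative f (at x)) ^^ n"

definition schwartz_space :: "(real \<Rightarrow> complex) set" where
  "schwartz_space =
     {f. (\<forall>n x. nth_vector_derivative n f differentiable at x) \<and>
         (\<forall>m n. bounded (range (\<lambda>x. of_real (x ^ m) * nth_vector_derivative n f x)))}"

definition fourier_transform :: "(real \<Rightarrow> complex) \<Rightarrow> real \<Rightarrow> complex" where
  "fourier_transform v \<xi> =
     1 / (2 * of_real pi) * (LBINT x. v x * exp (\<i> * of_real (x * \<xi>)))"

text \<open>The integrand is of order \<open>\<bar>z\<bar> powr (1 - 2 * \<alpha>)\<close> near \<open>0\<close>, so the integral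
  converges absolutely for \<open>\<alpha> < 1\<close>; its value \<open>0 / 0 = 0\<close> at the single
  point \<open>z = 0\<close> is irrelevant.\<close>

definition omega :: "real \<Rightarrow> real \<Rightarrow> real \<Rightarrow> real \<Rightarrow> real \<Rightarrow> real" where
  "omega \<rho> \<kappa> \<delta> \<alpha> \<xi> =
     sqrt (2 * \<kappa> / (\<rho> * \<delta> powr (2 * \<alpha>)) *
       (LBINT z:{-1..1}. (1 - cos (\<xi> * \<delta> * z)) / \<bar>z\<bar> powr (1 + 2 * \<alpha>)))"

definition sin_quotient :: "real \<Rightarrow> real \<Rightarrow> real \<Rightarrow> real \<Rightarrow> real \<Rightarrow> real \<Rightarrow> real" where
  "sin_quotient \<rho> \<kappa> \<delta> \<alpha> t \<xi> =
     (if \<xi> = 0 then t else sin (omega \<rho> \<kappa> \<delta> \<alpha> \<xi> * t) / omega \<rho> \<kappa> \<delta> \<alpha> \<xi>)"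

definition solution_u ::
  "real \<Rightarrow> real \<Rightarrow> real \<Rightarrow> real \<Rightarrow> (real \<Rightarrow> complex) \<Rightarrow> (real \<Rightarrow> complex) \<Rightarrow> real \<Rightarrow> real \<Rightarrow> complex" where
  "solution_u \<rho> \<kappa> \<delta> \<alpha> v\<^sub>0 v\<^sub>1 t x =
     (LBINT \<xi>. exp (- \<i> * of_real (\<xi> * x)) *
        (fourier_transform v\<^sub>0 \<xi> * of_real (cos (omega \<rho> \<kappa> \<delta> \<alpha> \<xi> * t)) +
         fourier_transform v\<^sub>1 \<xi> * of_real (sin_quotient \<rho> \<kappa> \<delta> \<alpha> t \<xi>)))"

end

theory Submission
  imports Defs "HOL-Probability.Characteristic_Functions" "HOL-Probability.Sinc_Integral"
begin

text \<open>
  On the Fourier side the solution at time \<open>t\<close> is obtained from the Schwartz functions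
  \<open>fourier_transform v\<^sub>0\<close> and \<open>fourier_transform v\<^sub>1\<close> by multiplication with \<open>cos (\<omega> * t)\<close> and
  \<open>sin (\<omega> * t) / \<omega>\<close>, followed by an inverse Fourier integral. Since Fourier integrals preserve the
  Schwartz space (\<open>exp_integral_schwartz_space\<close>) and so does multiplication by a smooth function all
  of whose derivatives grow at most polynomially (\<open>schwartz_space_mult\<close>), it suffices that these two
  multipliers are of that kind.

  The frequency \<open>\<omega>\<close> is not smooth at \<open>0\<close>, where it vanishes like \<open>\<bar>\<xi>\<bar>\<close>. But both multipliers are
  functions of \<open>\<omega>\<^sup>2\<close>: the first is \<open>Y (\<omega>\<^sup>2)\<close> for the entire function \<open>Y s = cos (t * sqrt s)\<close>, and the
  second, for \<open>t > 0\<close>, is \<open>-2 / t * Y' (\<omega>\<^sup>2)\<close>; for \<open>t = 0\<close> it vanishes. By the chain rule (\<open>derivs_in_poly_growth_compose\<close>) two facts remain.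

  \<^item> Every derivative of \<open>Y\<close> is bounded on \<open>s \<ge> 0\<close> (\<open>cos_sqrt_deriv_bounded\<close>). On \<open>0 \<le> s \<le> 1\<close> this is
    compactness; for \<open>s \<ge> 1\<close> it follows by induction from the linear differential equation that
    \<open>Y\<close> satisfies (\<open>cos_sqrt_deriv_ode\<close>).

  \<^item> \<open>\<omega>\<^sup>2\<close> is smooth with derivatives of polynomial growth (\<open>symbol_poly_growth\<close>). It is a constant
    times the integral of \<open>1 - cos (\<xi> * \<delta> * z)\<close> against \<open>\<bar>z\<bar> powr - (1 + 2 * \<alpha>)\<close> over \<open>{-1..1}\<close>. Each
    derivative in \<open>\<xi>\<close> brings down a factor \<open>z\<close>, so the integrand and all its derivatives
    are \<open>O(z\<^sup>2)\<close> times the kernel, and this is integrable for \<open>\<alpha> < 1\<close>.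
\<close>

section \<open>Iterated derivatives within a class of functions\<close>

text \<open>
  The recursion peels off the innermost derivative and only asserts that some \<open>f'\<close> exists, so closure
  properties are proved by induction on \<open>k\<close> by exhibiting \<open>f'\<close>, and no formula for a higher
  derivative is ever needed.
\<close>

primrec derivs_in :: "((real \<Rightarrow> 'a::real_normed_vector) \<Rightarrow> bool) \<Rightarrow> nat \<Rightarrow> (real \<Rightarrow> 'a) \<Rightarrow> bool" where
  "derivs_in B 0 f \<longleftrightarrow> B f"
| "derivs_in B (Suc k) f \<longleftrightarrow>
     B f \<and> (\<exists>f'. (\<forall>x. (f has_vector_derivative f' x) (at x)) \<and> derivs_in B k f')"

definition rapidly_decreasing :: "(real \<Rightarrow> complex) \<Rightarrow> bool" where
  "rapidly_decreasing f \<longleftrightarrow> (\<forall>m. bounded (range (\<lambda>x. of_real (x ^ m) * f x)))"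

definition poly_growth :: "(real \<Rightarrow> 'a::real_normed_vector) \<Rightarrow> bool" where
  "poly_growth f \<longleftrightarrow> (\<exists>C m. \<forall>x. norm (f x) \<le> C * (1 + \<bar>x\<bar>) ^ m)"

lemma derivs_inD: "derivs_in B k f \<Longrightarrow> B f"
  by (cases k) auto

lemma derivs_in_SucD: "derivs_in B (Suc k) f \<Longrightarrow> derivs_in B k f"
  by (induction k arbitrary: f) auto

lemma derivs_in_SucI:
  assumes "B f" "\<And>x. (f has_vector_derivative f' x) (at x)" "derivs_in B k f'"
  shows "derivs_in B (Suc k) f"
  using assms by auto

lemma derivs_in_add:
  assumes "\<And>f g. B f \<Longrightarrow> B g \<Longrightarrow> B (\<lambda>x. f x + g x)"
    and "derivs_in B k f" "derivs_in B k g"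
  shows "derivs_in B k (\<lambda>x. f x + g x)"
  using assms(2,3)
proof (induction k arbitrary: f g)
  case 0
  then show ?case using assms(1) by simp
next
  case (Suc k)
  then obtain f' g' where
    f': "\<And>x. (f has_vector_derivative f' x) (at x)" "derivs_in B k f'" and
    g': "\<And>x. (g has_vector_derivative g' x) (at x)" "derivs_in B k g'"
    by auto
  have "((\<lambda>x. f x + g x) has_vector_derivative f' x + g' x) (at x)" for x
    by (intro has_vector_derivative_add f' g')
  then show ?case
    using assms(1)[OF derivs_inD[OF Suc.prems(1)] derivs_inD[OF Suc.prems(2)]]
      Suc.IH[OF f'(2) g'(2)] by (intro derivs_in_SucI)
qed

text \<open>
  One application of the product rule per derivative replaces the full Leibniz formula: \<open>f * g'\<close> and
  \<open>f' * g\<close> are again products of the same kind, with one derivative less available. Three classes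
  are allowed so that both (rapid decrease) times (polynomial growth) and (polynomial growth) times
  (polynomial growth) are instances.
\<close>

lemma derivs_in_mult:
  fixes f g :: "real \<Rightarrow> 'a::real_normed_algebra"
  assumes mult: "\<And>f g. P f \<Longrightarrow> Q g \<Longrightarrow> R (\<lambda>x. f x * g x)"
    and add: "\<And>f g. R f \<Longrightarrow> R g \<Longrightarrow> R (\<lambda>x. f x + g x)"
    and "derivs_in P k f" "derivs_in Q k g"
  shows "derivs_in R k (\<lambda>x. f x * g x)"
  using assms(3,4)
proof (induction k arbitrary: f g)
  case 0
  then show ?case using mult by simp
next
  case (Suc k)
  then obtain f' g' where f': "\<And>x. (f has_vector_derivative f' x) (at x)" "derivs_in P k f'"
    and g': "\<And>x. (g has_vector_derivative g' x) (at x)" "derivs_in Q k g'"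
    by auto
  have derivs: "derivs_in R k (\<lambda>x. f x * g' x + f' x * g x)"
    by (rule derivs_in_add[OF add Suc.IH[OF derivs_in_SucD[OF Suc.prems(1)] g'(2)]
          Suc.IH[OF f'(2) derivs_in_SucD[OF Suc.prems(2)]]])
  have "((\<lambda>x. f x * g x) has_vector_derivative f x * g' x + f' x * g x) (at x)" for x
    by (intro has_vector_derivative_mult f' g')
  then show ?case
    using mult[OF derivs_inD[OF Suc.prems(1)] derivs_inD[OF Suc.prems(2)]] derivs
    by (intro derivs_in_SucI)
qed

lemma derivs_in_bounded_linear:
  assumes L: "bounded_linear L" and PQ: "\<And>f. P f \<Longrightarrow> Q (\<lambda>x. L (f x))"
    and "derivs_in P k f"
  shows "derivs_in Q k (\<lambda>x. L (f x))"
  using assms(3)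
proof (induction k arbitrary: f)
  case 0
  then show ?case using PQ by simp
next
  case (Suc k)
  then obtain f' where f': "\<And>x. (f has_vector_derivative f' x) (at x)" "derivs_in P k f'"
    by auto
  have "((\<lambda>x. L (f x)) has_vector_derivative L (f' x)) (at x)" for x
    by (intro bounded_linear.has_vector_derivative[OF L] f')
  then show ?case
    using PQ[OF derivs_inD[OF Suc.prems]] Suc.IH[OF f'(2)] by (intro derivs_in_SucI)
qed

lemma schwartz_space_imp_derivs_in:
  assumes "f \<in> schwartz_space"
  shows "derivs_in rapidly_decreasing k f"
proof -
  have "derivs_in rapidly_decreasing k (nth_vector_derivative n f)" for n
  proof (induction k arbitrary: n)
    case 0
    then show ?case using assms by (auto simp: rapidly_decreasing_def schwartz_space_def)
  next
    case (Suc k)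
    have "(nth_vector_derivative n f has_vector_derivative nth_vector_derivative (Suc n) f x) (at x)" for x
    proof -
      have "nth_vector_derivative n f differentiable at x"
        using assms by (auto simp: schwartz_space_def)
      then show ?thesis
        unfolding vector_derivative_works by (simp add: nth_vector_derivative_def)
    qed
    then show ?case using assms Suc
      by (auto simp: rapidly_decreasing_def schwartz_space_def intro!: exI[of _ "nth_vector_derivative (Suc n) f"])
  qed
  from this[of 0] show ?thesis by (simp add: nth_vector_derivative_def)
qed

text \<open>
  Derivatives are unique, so the witnesses hidden in \<open>derivs_in\<close> are the iterates of
  \<open>vector_derivative\<close>. One order more than \<open>n\<close> is needed, since it is what makes the \<open>n\<close>-th iterate
  differentiable.
\<close>

lemma nth_vector_derivative_of_derivs_in:
  assumes "derivs_in B (Suc k) f" "n \<le> k"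
  shows "(\<forall>x. nth_vector_derivative n f differentiable at x) \<and> B (nth_vector_derivative n f)"
  using assms
proof (induction n arbitrary: f k)
  case 0
  then show ?case
    by (auto simp: nth_vector_derivative_def dest: differentiableI_vector)
next
  case (Suc n)
  then obtain f' l where f': "\<And>x. (f has_vector_derivative f' x) (at x)" "derivs_in B (Suc l) f'" "n \<le> l"
    by (cases k) auto
  have "(\<lambda>x. vector_derivative f (at x)) = f'"
    using f'(1) by (auto simp: vector_derivative_at)
  then have "nth_vector_derivative (Suc n) f = nth_vector_derivative n f'"
    by (simp add: nth_vector_derivative_def funpow_Suc_right del: funpow.simps)
  with Suc.IH[OF f'(2,3)] show ?case by simp
qed

lemma schwartz_space_iff: "f \<in> schwartz_space \<longleftrightarrow> (\<forall>k. derivs_in rapidly_decreasing k f)"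
proof
  assume "\<forall>k. derivs_in rapidly_decreasing k f"
  then have "(\<forall>x. nth_vector_derivative n f differentiable at x) \<and>
      rapidly_decreasing (nth_vector_derivative n f)" for n
    using nth_vector_derivative_of_derivs_in[of rapidly_decreasing n f n] by blast
  then show "f \<in> schwartz_space" unfolding schwartz_space_def rapidly_decreasing_def by blast
qed (use schwartz_space_imp_derivs_in in blast)

section \<open>Rapid decrease and polynomial growth\<close>

lemma rapidly_decreasing_iff:
  "rapidly_decreasing f \<longleftrightarrow> (\<forall>m. \<exists>C. \<forall>x. \<bar>x\<bar> ^ m * norm (f x) \<le> C)"
  unfolding rapidly_decreasing_def bounded_iff
  by (simp add: norm_mult norm_power power_abs)

text \<open>
  Expanding one factor \<open>1 + \<bar>x\<bar>\<close> at a time gives the bound with the weight \<open>(1 + \<bar>x\<bar>) ^ m\<close>, which,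
  unlike \<open>\<bar>x\<bar> ^ m\<close>, also controls \<open>f\<close> near the origin and absorbs polynomial growth directly.
\<close>

lemma rapidly_decreasingD:
  assumes "rapidly_decreasing f"
  obtains C where "\<And>x. (1 + \<bar>x\<bar>) ^ m * norm (f x) \<le> C"
proof -
  have "\<exists>C. \<forall>x. \<bar>x\<bar> ^ j * ((1 + \<bar>x\<bar>) ^ m * norm (f x)) \<le> C" for j
  proof (induction m arbitrary: j)
    case 0
    then show ?case using assms by (simp add: rapidly_decreasing_iff)
  next
    case (Suc m)
    obtain C D where C: "\<And>x. \<bar>x\<bar> ^ j * ((1 + \<bar>x\<bar>) ^ m * norm (f x)) \<le> C"
      and D: "\<And>x. \<bar>x\<bar> ^ Suc j * ((1 + \<bar>x\<bar>) ^ m * norm (f x)) \<le> D"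
      using Suc by meson
    have "\<bar>x\<bar> ^ j * ((1 + \<bar>x\<bar>) ^ Suc m * norm (f x)) \<le> C + D" for x
      using add_mono[OF C[of x] D[of x]] by (simp add: algebra_simps)
    then show ?case by blast
  qed
  from this[of 0] that show thesis by auto
qed

lemma rapidly_decreasing_add:
  assumes "rapidly_decreasing f" "rapidly_decreasing g"
  shows "rapidly_decreasing (\<lambda>x. f x + g x)"
  unfolding rapidly_decreasing_iff
proof
  fix m
  obtain C D where C: "\<And>x. \<bar>x\<bar> ^ m * norm (f x) \<le> C" and D: "\<And>x. \<bar>x\<bar> ^ m * norm (g x) \<le> D"
    using assms unfolding rapidly_decreasing_iff by meson
  have "\<bar>x\<bar> ^ m * norm (f x + g x) \<le> C + D" for x
  proof -
    have "\<bar>x\<bar> ^ m * norm (f x + g x) \<le> \<bar>x\<bar> ^ m * (norm (f x) + norm (g x))"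
      by (intro mult_left_mono norm_triangle_ineq) auto
    also have "\<dots> \<le> C + D" using add_mono[OF C[of x] D[of x]] by (simp add: algebra_simps)
    finally show ?thesis .
  qed
  then show "\<exists>C. \<forall>x. \<bar>x\<bar> ^ m * norm (f x + g x) \<le> C" by blast
qed

lemma poly_growthE:
  assumes "poly_growth f"
  obtains C m where "C \<ge> 0" "\<And>x. norm (f x) \<le> C * (1 + \<bar>x\<bar>) ^ m"
proof -
  obtain C m where C: "\<And>x. norm (f x) \<le> C * (1 + \<bar>x\<bar>) ^ m"
    using assms by (auto simp: poly_growth_def)
  have "0 \<le> C" using order_trans[OF norm_ge_zero C[of 0]] by simp
  with C that show thesis by blast
qed

lemma rapidly_decreasing_mult_poly_growth:
  assumes "rapidly_decreasing f" "poly_growth g"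
  shows "rapidly_decreasing (\<lambda>x. f x * g x)"
  unfolding rapidly_decreasing_iff
proof
  fix m
  obtain C p where C: "C \<ge> 0" "\<And>x. norm (g x) \<le> C * (1 + \<bar>x\<bar>) ^ p"
    using poly_growthE[OF assms(2)] by blast
  obtain D where D: "\<And>x. (1 + \<bar>x\<bar>) ^ (m + p) * norm (f x) \<le> D"
    using rapidly_decreasingD[OF assms(1)] by blast
  have "\<bar>x\<bar> ^ m * norm (f x * g x) \<le> C * D" for x
  proof -
    have "\<bar>x\<bar> ^ m * norm (f x * g x) \<le> (1 + \<bar>x\<bar>) ^ m * (norm (f x) * (C * (1 + \<bar>x\<bar>) ^ p))"
      unfolding norm_mult using C by (intro mult_mono power_mono mult_left_mono) auto
    also have "\<dots> = C * ((1 + \<bar>x\<bar>) ^ (m + p) * norm (f x))" by (simp add: power_add)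
    also have "\<dots> \<le> C * D" by (intro mult_left_mono D C)
    finally show ?thesis .
  qed
  then show "\<exists>C. \<forall>x. \<bar>x\<bar> ^ m * norm (f x * g x) \<le> C" by blast
qed

lemma poly_growth_add:
  assumes "poly_growth f" "poly_growth g"
  shows "poly_growth (\<lambda>x. f x + g x)"
proof -
  obtain C m where C: "C \<ge> 0" "\<And>x. norm (f x) \<le> C * (1 + \<bar>x\<bar>) ^ m"
    using poly_growthE[OF assms(1)] by blast
  obtain D n where D: "D \<ge> 0" "\<And>x. norm (g x) \<le> D * (1 + \<bar>x\<bar>) ^ n"
    using poly_growthE[OF assms(2)] by blast
  have "norm (f x + g x) \<le> (C + D) * (1 + \<bar>x\<bar>) ^ (m + n)" for x
  proof -
    have "norm (f x + g x) \<le> C * (1 + \<bar>x\<bar>) ^ m + D * (1 + \<bar>x\<bar>) ^ n"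
      using norm_triangle_mono[OF C(2) D(2)] .
    also have "\<dots> \<le> C * (1 + \<bar>x\<bar>) ^ (m + n) + D * (1 + \<bar>x\<bar>) ^ (m + n)"
      using C(1) D(1) by (intro add_mono mult_left_mono power_increasing) auto
    finally show ?thesis by (simp add: algebra_simps)
  qed
  then show ?thesis unfolding poly_growth_def by blast
qed

lemma poly_growth_mult:
  fixes f g :: "real \<Rightarrow> 'a::real_normed_algebra"
  assumes "poly_growth f" "poly_growth g"
  shows "poly_growth (\<lambda>x. f x * g x)"
proof -
  obtain C m where C: "C \<ge> 0" "\<And>x. norm (f x) \<le> C * (1 + \<bar>x\<bar>) ^ m"
    using poly_growthE[OF assms(1)] by blast
  obtain D n where D: "D \<ge> 0" "\<And>x. norm (g x) \<le> D * (1 + \<bar>x\<bar>) ^ n"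
    using poly_growthE[OF assms(2)] by blast
  have "norm (f x * g x) \<le> (C * D) * (1 + \<bar>x\<bar>) ^ (m + n)" for x
  proof -
    have "norm (f x * g x) \<le> norm (f x) * norm (g x)" by (rule norm_mult_ineq)
    also have "\<dots> \<le> (C * (1 + \<bar>x\<bar>) ^ m) * (D * (1 + \<bar>x\<bar>) ^ n)"
      using C(1) D(1) by (intro mult_mono C D) auto
    finally show ?thesis by (simp add: power_add mult_ac)
  qed
  then show ?thesis unfolding poly_growth_def by blast
qed

lemma poly_growth_bounded_linear:
  assumes "bounded_linear L" "poly_growth f"
  shows "poly_growth (\<lambda>x. L (f x))"
proof -
  obtain C m where C: "C \<ge> 0" "\<And>x. norm (f x) \<le> C * (1 + \<bar>x\<bar>) ^ m"
    using poly_growthE[OF assms(2)] by blast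
  obtain K where K: "K > 0" "\<And>x. norm (L x) \<le> norm x * K"
    using bounded_linear.pos_bounded[OF assms(1)] by blast
  have "norm (L (f x)) \<le> (C * K) * (1 + \<bar>x\<bar>) ^ m" for x
    using order_trans[OF K(2) mult_right_mono[OF C(2), of K]] K(1) by (simp add: mult_ac)
  then show ?thesis unfolding poly_growth_def by blast
qed

lemma derivs_in_poly_growth_bounded_linear:
  assumes "bounded_linear L" "derivs_in poly_growth k f"
  shows "derivs_in poly_growth k (\<lambda>x. L (f x))"
  using assms(1) poly_growth_bounded_linear[OF assms(1)] assms(2) by (rule derivs_in_bounded_linear)

text \<open>
  The derivative of \<open>Y n \<circ> w\<close> is \<open>(Y (Suc n) \<circ> w) * w'\<close>. Stating the claim for all \<open>n\<close> at once makes
  the induction hypothesis applicable to the first factor and replaces Faa di Bruno's formula.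
  Boundedness of the \<open>Y n\<close> is asked for only on the range of \<open>w\<close>, because the entire function
  extending \<open>cos (t * sqrt s)\<close> is \<open>cosh (t * sqrt (- s))\<close> for \<open>s < 0\<close>.
\<close>

lemma derivs_in_poly_growth_compose:
  fixes Y :: "nat \<Rightarrow> real \<Rightarrow> real"
  assumes Y: "\<And>n s. (Y n has_real_derivative Y (Suc n) s) (at s)"
    and bdd: "\<And>n x. \<bar>Y n (w x)\<bar> \<le> M n"
    and w: "\<And>k. derivs_in poly_growth k w"
  shows "derivs_in poly_growth k (\<lambda>x. Y n (w x))"
proof (induction k arbitrary: n)
  case 0
  have "\<bar>Y n (w x)\<bar> \<le> M n * (1 + \<bar>x\<bar>) ^ 0" for x using bdd by simp
  then show ?case unfolding derivs_in.simps poly_growth_def real_norm_def by blast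
next
  case (Suc k)
  obtain w' where w': "\<And>x. (w has_vector_derivative w' x) (at x)" "derivs_in poly_growth k w'"
    using w[of "Suc k"] by auto
  have "((\<lambda>x. Y n (w x)) has_vector_derivative Y (Suc n) (w x) * w' x) (at x)" for x
    using DERIV_chain2[OF Y] w'(1) by (auto simp: has_real_derivative_iff_has_vector_derivative)
  moreover have "derivs_in poly_growth k (\<lambda>x. Y (Suc n) (w x) * w' x)"
    by (intro derivs_in_mult[of poly_growth poly_growth] poly_growth_mult poly_growth_add Suc w')
  ultimately show ?case
    using derivs_inD[OF Suc[of n]] by (intro derivs_in_SucI)
qed

lemma schwartz_space_mult:
  assumes "f \<in> schwartz_space" "\<And>k. derivs_in poly_growth k g"
  shows "(\<lambda>x. f x * g x) \<in> schwartz_space"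
proof (unfold schwartz_space_iff, intro allI)
  show "derivs_in rapidly_decreasing k (\<lambda>x. f x * g x)" for k
    by (intro derivs_in_mult[of rapidly_decreasing poly_growth rapidly_decreasing]
        rapidly_decreasing_mult_poly_growth rapidly_decreasing_add
        schwartz_space_imp_derivs_in assms)
qed

lemma schwartz_space_add:
  assumes "f \<in> schwartz_space" "g \<in> schwartz_space"
  shows "(\<lambda>x. f x + g x) \<in> schwartz_space"
proof (unfold schwartz_space_iff, intro allI)
  show "derivs_in rapidly_decreasing k (\<lambda>x. f x + g x)" for k
    by (intro derivs_in_add rapidly_decreasing_add schwartz_space_imp_derivs_in assms)
qed

lemma derivs_in_poly_growth_linear:
  fixes a b :: "'a::real_normed_algebra_1"
  shows "derivs_in poly_growth k (\<lambda>x. a * of_real x + b)"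
proof -
  have const: "poly_growth (\<lambda>x. c)" for c :: 'a
    unfolding poly_growth_def by (intro exI[of _ "norm c"] exI[of _ "0::nat"]) simp
  have dconst: "derivs_in poly_growth k (\<lambda>x. c)" for k and c :: 'a
  proof (induction k arbitrary: c)
    case (Suc k)
    then show ?case using const by (auto intro!: exI[of _ "\<lambda>x. 0"])
  qed (simp add: const)
  have x: "poly_growth (\<lambda>x. of_real x :: 'a)"
    unfolding poly_growth_def by (auto intro!: exI[of _ 1] exI[of _ 1])
  have lin: "poly_growth (\<lambda>x. a * of_real x + b)"
    using poly_growth_add[OF poly_growth_mult[OF const x] const] .
  have "((\<lambda>x. a * of_real x + b) has_vector_derivative a) (at x)" for x
    by (auto intro!: derivative_eq_intros)
  then have "derivs_in poly_growth (Suc j) (\<lambda>x. a * of_real x + b)" for j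
    by (rule derivs_in_SucI[OF lin _ dconst])
  with lin show ?thesis by (cases k) simp_all
qed

lemma schwartz_space_cmult: "f \<in> schwartz_space \<Longrightarrow> (\<lambda>x. c * f x) \<in> schwartz_space"
  using schwartz_space_mult[of f "\<lambda>x. c"] derivs_in_poly_growth_linear[of _ 0 c]
  by (simp add: mult.commute)

lemma schwartz_space_derivative:
  assumes "f \<in> schwartz_space"
  obtains f' where "f' \<in> schwartz_space" "\<And>x. (f has_vector_derivative f' x) (at x)"
proof
  define f' where "f' = (\<lambda>x. vector_derivative f (at x))"
  show d: "(f has_vector_derivative f' x) (at x)" for x
    using schwartz_space_imp_derivs_in[OF assms, of 1]
    by (auto simp: f'_def intro: vector_derivative_works[THEN iffD1] differentiableI_vector)
  show "f' \<in> schwartz_space"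
    unfolding schwartz_space_iff
  proof
    fix k
    obtain g where g: "\<And>x. (f has_vector_derivative g x) (at x)" "derivs_in rapidly_decreasing k g"
      using schwartz_space_imp_derivs_in[OF assms, of "Suc k"] by auto
    have "g = f'" using d g(1) vector_derivative_unique_at by blast
    with g show "derivs_in rapidly_decreasing k f'" by simp
  qed
qed

section \<open>Differentiating oscillatory integrals\<close>

lemma has_vector_derivative_quadratic_remainder:
  fixes F :: "real \<Rightarrow> 'a::real_normed_vector"
  assumes "\<And>h. norm (F (x + h) - F x - h *\<^sub>R F') \<le> C * h\<^sup>2"
  shows "(F has_vector_derivative F') (at x)"
  unfolding has_vector_derivative_def has_derivative_at
proof
  show "bounded_linear (\<lambda>h. h *\<^sub>R F')" by (rule bounded_linear_scaleR_left)
  have "norm (norm (F (x + h) - F x - h *\<^sub>R F') / norm h) \<le> C * \<bar>h\<bar>" for h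
  proof (cases "h = 0")
    case False
    then show ?thesis using assms[of h] by (simp add: divide_simps power2_eq_square mult.assoc)
  qed simp
  then have "\<forall>\<^sub>F h in at 0. norm (norm (F (x + h) - F x - h *\<^sub>R F') / norm h) \<le> C * \<bar>h\<bar>"
    by simp
  moreover have "((\<lambda>h. C * \<bar>h\<bar>) \<longlongrightarrow> 0) (at 0)"
    by (auto intro!: tendsto_eq_intros)
  ultimately show "((\<lambda>h. norm (F (x + h) - F x - h *\<^sub>R F') / norm h) \<longlongrightarrow> 0) (at 0)"
    by (rule Lim_null_comparison)
qed

text \<open>
  If the first-order Taylor remainder of the integrand is dominated by \<open>h\<^sup>2\<close> times an integrable
  function, differentiation under the integral sign is a direct estimate. Oscillatory
  exponentials satisfy this as soon as the second moment of their weight is finite.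
\<close>

lemma integral_has_vector_derivative_quadratic_remainder:
  fixes A A' :: "real \<Rightarrow> real \<Rightarrow> complex"
  assumes A: "\<And>x. integrable lborel (A x)" and A': "\<And>x. integrable lborel (A' x)"
    and b: "integrable lborel b"
    and remainder: "\<And>x h z. norm (A (x + h) z - A x z - h *\<^sub>R A' x z) \<le> h\<^sup>2 * b z"
  shows "((\<lambda>x. LBINT z. A x z) has_vector_derivative (LBINT z. A' x z)) (at x)"
proof (rule has_vector_derivative_quadratic_remainder)
  fix h
  have int: "integrable lborel (\<lambda>z. A (x + h) z - A x z - h *\<^sub>R A' x z)"
    by (rule Bochner_Integration.integrable_diff[OF Bochner_Integration.integrable_diff[OF A A]
          integrable_scaleR_right[OF A']])
  have "(LBINT z. A (x + h) z) - (LBINT z. A x z) - h *\<^sub>R (LBINT z. A' x z)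
      = (LBINT z. A (x + h) z - A x z - h *\<^sub>R A' x z)"
    by (simp only: Bochner_Integration.integral_diff[OF Bochner_Integration.integrable_diff[OF A A]
          integrable_scaleR_right[OF A']]
        Bochner_Integration.integral_diff[OF A A] integral_scaleR_right)
  also have "norm \<dots> \<le> (LBINT z. norm (A (x + h) z - A x z - h *\<^sub>R A' x z))"
    by (rule integral_norm_bound)
  also have "\<dots> \<le> (LBINT z. h\<^sup>2 * b z)"
    by (rule integral_mono[OF integrable_norm[OF int] integrable_mult_right[OF b] remainder])
  also have "\<dots> = (LBINT z. b z) * h\<^sup>2"
    unfolding integral_mult_right_zero by (rule mult.commute)
  finally show "norm ((LBINT z. A (x + h) z) - (LBINT z. A x z) - h *\<^sub>R (LBINT z. A' x z))
      \<le> (LBINT z. b z) * h\<^sup>2" .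
qed

lemma norm_iexp_remainder:
  "norm (iexp \<theta> - 1) \<le> \<bar>\<theta>\<bar>" "norm (iexp \<theta> - 1 - \<i> * \<theta>) \<le> \<theta>\<^sup>2 / 2"
  using iexp_approx1[of \<theta> 0] iexp_approx1[of \<theta> 1] by (simp_all add: power2_eq_square algebra_simps)

section \<open>The Fourier integral of a Schwartz function\<close>

text \<open>
  With \<open>s = 1\<close> this is the Fourier transform times \<open>2 * pi\<close>, and with \<open>s = -1\<close> the inverse transform.
\<close>

definition exp_integral :: "real \<Rightarrow> (real \<Rightarrow> complex) \<Rightarrow> real \<Rightarrow> complex" where
  "exp_integral s g x = (LBINT y. g y * iexp (s * x * y))"

lemma schwartz_space_measurable:
  assumes "g \<in> schwartz_space"
  shows "g \<in> borel_measurable borel"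
proof (rule borel_measurable_continuous_onI)
  obtain g' where "\<And>x. (g has_vector_derivative g' x) (at x)"
    by (rule schwartz_space_derivative[OF assms]) (rule that)
  then show "continuous_on UNIV g"
    by (auto intro!: continuous_at_imp_continuous_on intro: has_vector_derivative_continuous)
qed

lemma schwartz_space_integrable:
  assumes "g \<in> schwartz_space"
  shows "integrable lborel g"
proof -
  obtain C where C: "\<And>x. (1 + \<bar>x\<bar>) ^ 2 * norm (g x) \<le> C"
    by (rule rapidly_decreasingD[OF derivs_inD[OF schwartz_space_imp_derivs_in[OF assms]], where m = 2])
      (rule that)
  show ?thesis
  proof (rule Bochner_Integration.integrable_bound)
    show "integrable lborel (\<lambda>x. C * inverse (1 + x\<^sup>2))"
      using integrable_inverse_1_plus_square by (simp add: set_integrable_def)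
    have "norm (g x) \<le> norm (C * inverse (1 + x\<^sup>2))" for x
    proof -
      have "1 + x\<^sup>2 \<le> (1 + \<bar>x\<bar>)\<^sup>2" by (simp add: power2_eq_square algebra_simps)
      then have "(1 + x\<^sup>2) * norm (g x) \<le> C"
        by (rule order_trans[OF mult_right_mono C[of x]]) simp
      moreover have "1 + x\<^sup>2 > 0" by (simp add: add_pos_nonneg)
      ultimately have "norm (g x) \<le> C * inverse (1 + x\<^sup>2)"
        by (simp add: field_simps)
      then show ?thesis by simp
    qed
    then show "AE x in lborel. norm (g x) \<le> norm (C * inverse (1 + x\<^sup>2))" by simp
  qed (use schwartz_space_measurable[OF assms] in simp)
qed

lemma integrable_mult_iexp:
  assumes "integrable lborel g"
  shows "integrable lborel (\<lambda>y. g y * iexp (s * x * y))"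
  by (rule Bochner_Integration.integrable_bound[OF assms])
    (use assms in \<open>auto simp: norm_mult\<close>)

lemma schwartz_space_mult_id: "g \<in> schwartz_space \<Longrightarrow> (\<lambda>y. a * of_real y * g y) \<in> schwartz_space"
  using schwartz_space_mult[of g "\<lambda>y. a * of_real y"] derivs_in_poly_growth_linear[of _ a 0]
  by (simp add: mult.commute)

lemma exp_integral_has_vector_derivative:
  assumes g: "g \<in> schwartz_space"
  shows "(exp_integral s g has_vector_derivative exp_integral s (\<lambda>y. \<i> * of_real s * of_real y * g y) x) (at x)"
  unfolding exp_integral_def[abs_def]
proof (rule integral_has_vector_derivative_quadratic_remainder[where
      A = "\<lambda>x y. g y * iexp (s * x * y)" and
      A' = "\<lambda>x y. \<i> * of_real s * of_real y * g y * iexp (s * x * y)" and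
      b = "\<lambda>y. norm (of_real s * of_real y * (of_real s * of_real y * g y))"])
  show "integrable lborel (\<lambda>y. g y * iexp (s * x * y))"
    "integrable lborel (\<lambda>y. \<i> * of_real s * of_real y * g y * iexp (s * x * y))" for x
    by (intro integrable_mult_iexp schwartz_space_integrable schwartz_space_mult_id g)+
  show "integrable lborel (\<lambda>y. norm (of_real s * of_real y * (of_real s * of_real y * g y)))"
    by (intro integrable_norm schwartz_space_integrable schwartz_space_mult_id g)
  fix x h y
  have "g y * iexp (s * (x + h) * y) - g y * iexp (s * x * y)
      - h *\<^sub>R (\<i> * of_real s * of_real y * g y * iexp (s * x * y))
    = g y * iexp (s * x * y) * (iexp (s * h * y) - 1 - \<i> * (s * h * y))"
    by (simp add: scaleR_conv_of_real algebra_simps exp_add[symmetric])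
  also have "norm \<dots> = norm (g y) * norm (iexp (s * h * y) - 1 - \<i> * (s * h * y))"
    by (simp add: norm_mult)
  also have "\<dots> \<le> norm (g y) * ((s * h * y)\<^sup>2 / 2)"
    by (intro mult_left_mono norm_iexp_remainder) simp
  also have "\<dots> \<le> norm (g y) * (s * h * y)\<^sup>2"
    by (intro mult_left_mono) auto
  also have "\<dots> = h\<^sup>2 * norm (of_real s * of_real y * (of_real s * of_real y * g y))"
  proof -
    have "norm (of_real s * of_real y * (of_real s * of_real y * g y)) = (\<bar>s\<bar> * \<bar>y\<bar>)\<^sup>2 * norm (g y)"
      by (simp add: norm_mult power2_eq_square)
    then show ?thesis by (simp add: power_mult_distrib)
  qed
  finally show "norm (g y * iexp (s * (x + h) * y) - g y * iexp (s * x * y)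
      - h *\<^sub>R (\<i> * of_real s * of_real y * g y * iexp (s * x * y)))
    \<le> h\<^sup>2 * norm (of_real s * of_real y * (of_real s * of_real y * g y))" .
qed

lemma schwartz_space_tendsto_0:
  assumes "g \<in> schwartz_space"
  shows "(g \<longlongrightarrow> 0) at_infinity"
proof -
  obtain C where C: "\<And>x. (1 + \<bar>x\<bar>) ^ 1 * norm (g x) \<le> C"
    by (rule rapidly_decreasingD[OF derivs_inD[OF schwartz_space_imp_derivs_in[OF assms]], where m = 1])
      (rule that)
  have le: "norm (g x) \<le> C / (1 + \<bar>x\<bar>)" for x
    using C[of x] by (simp add: field_simps)
  have "filterlim (\<lambda>x::real. 1 + \<bar>x\<bar>) at_top at_infinity"
    unfolding real_norm_def[symmetric]
    by (rule filterlim_tendsto_add_at_top[OF tendsto_const filterlim_norm_at_top])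
  then have "((\<lambda>x::real. C / (1 + \<bar>x\<bar>)) \<longlongrightarrow> 0) at_infinity"
    by (rule tendsto_divide_0[OF tendsto_const filterlim_at_top_imp_at_infinity])
  then show ?thesis
    by (rule Lim_null_comparison[OF always_eventually[OF allI[OF le]]])
qed

text \<open>
  Integration by parts in the form of the fundamental theorem on the whole line: the product
  \<open>g y * iexp (s * x * y)\<close> tends to \<open>0\<close> at both ends, so its derivative integrates to \<open>0\<close>.
\<close>

lemma exp_integral_derivative:
  assumes g: "g \<in> schwartz_space" and g': "g' \<in> schwartz_space"
    and deriv: "\<And>x. (g has_vector_derivative g' x) (at x)"
  shows "exp_integral s g' x = - (\<i> * of_real s * of_real x) * exp_integral s g x"
proof -
  let ?e = "\<lambda>y. iexp (s * x * y)"
  let ?F = "\<lambda>y. g y * ?e y" and ?f = "\<lambda>y. g' y * ?e y + (\<i> * of_real s * of_real x) * (g y * ?e y)"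
  have e: "(?e has_vector_derivative \<i> * of_real s * of_real x * ?e y) (at y)" for y
  proof -
    have "((\<lambda>z. exp (\<i> * of_real s * of_real x * z)) has_field_derivative
        \<i> * of_real s * of_real x * iexp (s * x * y)) (at (of_real y))"
      by (auto intro!: derivative_eq_intros simp: mult_ac)
    from has_vector_derivative_real_field[OF this] show ?thesis by (simp add: mult_ac)
  qed
  have F: "(?F has_vector_derivative ?f y) (at y)" for y
    by (rule has_vector_derivative_eq_rhs[OF has_vector_derivative_mult[OF deriv e]])
      (simp add: algebra_simps)
  obtain g'' where g'': "\<And>x. (g' has_vector_derivative g'' x) (at x)"
    by (rule schwartz_space_derivative[OF g']) (rule that)
  have "isCont g y" "isCont g' y" "isCont ?e y" for y
    using deriv[of y] g''[of y] e[of y] by (blast dest: has_vector_derivative_continuous)+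
  then have cont: "isCont ?f y" for y
    by (intro continuous_intros)
  have int_g: "integrable lborel ?F" and int_g': "integrable lborel (\<lambda>y. g' y * ?e y)"
    using g g' by (simp_all only: integrable_mult_iexp schwartz_space_integrable)
  then have int: "integrable lborel ?f"
    by (intro Bochner_Integration.integrable_add integrable_mult_right)
  have "(?F \<longlongrightarrow> 0) at_infinity"
    by (rule Lim_null_comparison[OF _ tendsto_norm_zero[OF schwartz_space_tendsto_0[OF g]]])
      (simp add: norm_mult)
  then have "(?F \<longlongrightarrow> 0) at_top" "(?F \<longlongrightarrow> 0) at_bot"
    using tendsto_mono[OF at_top_le_at_infinity] tendsto_mono[OF at_bot_le_at_infinity] by simp_all
  then have "(LBINT y=-\<infinity>..\<infinity>. ?f y) = 0 - 0"
    using F cont int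
    by (intro interval_integral_FTC_integrable)
      (auto simp: set_integrable_def at_left_PInf at_right_MInf filterlim_filtermap o_def)
  then have "(LBINT y. ?f y) = 0"
    by (simp add: interval_lebesgue_integral_def set_lebesgue_integral_def)
  also have "(LBINT y. ?f y) = exp_integral s g' x + (\<i> * of_real s * of_real x) * exp_integral s g x"
    unfolding exp_integral_def
    using int_g int_g' by simp
  finally show ?thesis by (simp add: add_eq_0_iff)
qed

lemma norm_exp_integral_le: "norm (exp_integral s g x) \<le> (LBINT y. norm (g y))"
  unfolding exp_integral_def
  using integral_norm_bound[of lborel "\<lambda>y. g y * iexp (s * x * y)"] by (simp add: norm_mult)

text \<open>
  Multiplying the transform by \<open>x\<close> amounts, up to a constant, to transforming the derivative, so each
  power of \<open>x\<close> costs one derivative of \<open>g\<close>, and the transform of an integrable function is bounded.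
\<close>

lemma exp_integral_rapidly_decreasing:
  assumes "s \<noteq> 0" "g \<in> schwartz_space"
  shows "rapidly_decreasing (exp_integral s g)"
proof -
  have "\<exists>C. \<forall>x. \<bar>x\<bar> ^ m * norm (exp_integral s g x) \<le> C" for m
    using assms(2)
  proof (induction m arbitrary: g)
    case 0
    then show ?case using norm_exp_integral_le by auto
  next
    case (Suc m)
    obtain g' where g': "g' \<in> schwartz_space" "\<And>x. (g has_vector_derivative g' x) (at x)"
      by (rule schwartz_space_derivative[OF Suc.prems]) (rule that)
    obtain C where C: "\<And>x. \<bar>x\<bar> ^ m * norm (exp_integral s g' x) \<le> C"
      using Suc.IH[OF g'(1)] by blast
    have "\<bar>x\<bar> ^ Suc m * norm (exp_integral s g x) \<le> C / \<bar>s\<bar>" for x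
      using C[of x] assms(1) exp_integral_derivative[OF Suc.prems g', of s x]
      by (simp add: norm_mult field_simps)
    then show ?case by blast
  qed
  then show ?thesis by (simp add: rapidly_decreasing_iff)
qed

text \<open>
  Differentiating the transform multiplies \<open>g\<close> by \<open>\<i> * s * y\<close>, which keeps it in the Schwartz space;
  hence the induction on the order of differentiation runs over all Schwartz functions \<open>g\<close>.
\<close>

lemma exp_integral_schwartz_space:
  assumes "s \<noteq> 0" "g \<in> schwartz_space"
  shows "exp_integral s g \<in> schwartz_space"
  unfolding schwartz_space_iff
proof
  show "derivs_in rapidly_decreasing k (exp_integral s g)" for k
    using assms(2)
  proof (induction k arbitrary: g)
    case 0
    then show ?case using exp_integral_rapidly_decreasing[OF assms(1)] by simp
  next
    case (Suc k)
    show ?case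
      using exp_integral_rapidly_decreasing[OF assms(1) Suc.prems]
        exp_integral_has_vector_derivative[OF Suc.prems]
        Suc.IH[OF schwartz_space_mult_id[OF Suc.prems]]
      by (intro derivs_in_SucI)
  qed
qed

section \<open>The entire function cos (t sqrt s)\<close>

text \<open>
  The \<open>n\<close>-th derivative in \<open>s\<close> of the entire function that equals \<open>cos (t * sqrt s)\<close> for \<open>s \<ge> 0\<close>. The
  square root is not smooth at \<open>0\<close>, but only even powers of it occur in the cosine series.
\<close>

definition cos_sqrt_deriv :: "real \<Rightarrow> nat \<Rightarrow> real \<Rightarrow> real" where
  "cos_sqrt_deriv t n s = (\<Sum>k. (diffs ^^ n) (\<lambda>j. (- 1) ^ j * t ^ (2 * j) / fact (2 * j)) k * s ^ k)"

lemma cos_sqrt_sums: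
  assumes "s \<ge> 0"
  shows "(\<lambda>k. (- 1) ^ k * t ^ (2 * k) / fact (2 * k) * s ^ k) sums cos (t * sqrt s)"
proof -
  have "(t * sqrt s) ^ (2 * k) = t ^ (2 * k) * s ^ k" for k
    using assms by (simp add: power_mult_distrib power_mult)
  then show ?thesis using cos_paired[of "t * sqrt s"] by (simp add: mult_ac)
qed

lemma cos_sqrt_deriv_0: "s \<ge> 0 \<Longrightarrow> cos_sqrt_deriv t 0 s = cos (t * sqrt s)"
  using sums_unique[OF cos_sqrt_sums] by (simp add: cos_sqrt_deriv_def)

lemma summable_cos_sqrt_deriv:
  "summable (\<lambda>k. (diffs ^^ n) (\<lambda>j. (- 1) ^ j * t ^ (2 * j) / fact (2 * j)) k * (s::real) ^ k)"
proof (induction n arbitrary: s)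
  case 0
  show ?case
    using powser_inside[OF sums_summable[OF cos_sqrt_sums[of "\<bar>s\<bar> + 1" t]], of s] by simp
next
  case (Suc n)
  then show ?case by (simp add: termdiff_converges_all)
qed

lemma cos_sqrt_deriv_has_real_derivative:
  "(cos_sqrt_deriv t n has_real_derivative cos_sqrt_deriv t (Suc n) s) (at s)"
  unfolding cos_sqrt_deriv_def[abs_def]
  using termdiffs_strong_converges_everywhere[OF summable_cos_sqrt_deriv] by simp

lemma cos_sqrt_deriv_unique:
  assumes "s > 0" "\<And>s. s > 0 \<Longrightarrow> cos_sqrt_deriv t n s = f s" "(f has_real_derivative D) (at s)"
  shows "cos_sqrt_deriv t (Suc n) s = D"
proof -
  have "(cos_sqrt_deriv t n has_real_derivative D) (at s)"
    using assms(2) by (intro has_field_derivative_transform_within_open[OF assms(3), of "{0<..}"])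
      (use assms(1) in auto)
  then show ?thesis using cos_sqrt_deriv_has_real_derivative DERIV_unique by blast
qed

lemma cos_sqrt_deriv_1:
  assumes "s > 0"
  shows "cos_sqrt_deriv t 1 s = - t * sin (t * sqrt s) / (2 * sqrt s)"
proof -
  have "((\<lambda>s. cos (t * sqrt s)) has_real_derivative - t * sin (t * sqrt s) / (2 * sqrt s)) (at s)"
    using assms by (auto intro!: derivative_eq_intros simp: field_simps)
  from cos_sqrt_deriv_unique[OF assms _ this] show ?thesis by (simp add: cos_sqrt_deriv_0)
qed

lemma cos_sqrt_deriv_1_0: "cos_sqrt_deriv t 1 0 = - t\<^sup>2 / 2"
  unfolding cos_sqrt_deriv_def powser_zero by (simp add: diffs_def power2_eq_square)

text \<open>
  The function \<open>y s = cos (t * sqrt s)\<close> solves \<open>4 * s * y'' + 2 * y' + t\<^sup>2 * y = 0\<close>; differentiating this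
  equation \<open>n\<close> times gives the recurrence.
\<close>

lemma cos_sqrt_deriv_ode:
  assumes "s > 0"
  shows "4 * s * cos_sqrt_deriv t (Suc (Suc n)) s + (4 * real n + 2) * cos_sqrt_deriv t (Suc n) s
    + t\<^sup>2 * cos_sqrt_deriv t n s = 0"
  using assms
proof (induction n arbitrary: s)
  case 0
  have [simp]: "sqrt s * (sqrt s * x) = s * x" for x
    using 0 by (simp add: mult.assoc[symmetric])
  have "((\<lambda>s. - t * sin (t * sqrt s) / (2 * sqrt s)) has_real_derivative
      - t\<^sup>2 * cos (t * sqrt s) / (4 * s) + t * sin (t * sqrt s) / (4 * s * sqrt s)) (at s)"
    using 0 by (auto intro!: derivative_eq_intros simp: field_simps power2_eq_square)
  from cos_sqrt_deriv_unique[OF 0 _ this] have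
    "cos_sqrt_deriv t (Suc (Suc 0)) s
      = - t\<^sup>2 * cos (t * sqrt s) / (4 * s) + t * sin (t * sqrt s) / (4 * s * sqrt s)"
    using cos_sqrt_deriv_1 by simp
  then have "4 * s * cos_sqrt_deriv t (Suc (Suc 0)) s = - t\<^sup>2 * cos (t * sqrt s) + t * sin (t * sqrt s) / sqrt s"
    using 0 by (simp add: field_simps)
  moreover have "2 * cos_sqrt_deriv t (Suc 0) s = - t * sin (t * sqrt s) / sqrt s"
    using cos_sqrt_deriv_1[OF 0, of t] by (simp add: field_simps)
  ultimately show ?case
    using 0 cos_sqrt_deriv_0[of s t] by simp
next
  case (Suc n)
  let ?Y = "cos_sqrt_deriv t"
  let ?f = "\<lambda>s. 4 * s * ?Y (Suc (Suc n)) s + (4 * real n + 2) * ?Y (Suc n) s + t\<^sup>2 * ?Y n s"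
  have "(?f has_real_derivative 4 * s * ?Y (Suc (Suc (Suc n))) s
      + (4 * real (Suc n) + 2) * ?Y (Suc (Suc n)) s + t\<^sup>2 * ?Y (Suc n) s) (at s)"
    by (auto intro!: derivative_eq_intros cos_sqrt_deriv_has_real_derivative simp: algebra_simps)
  moreover have "(?f has_real_derivative 0) (at s)"
    using Suc.IH by (intro has_field_derivative_transform_within_open[OF DERIV_const[of 0], of "{0<..}"])
      (use Suc.prems in auto)
  ultimately show ?case by (rule DERIV_unique)
qed

text \<open>
  The differential equation expresses each derivative through the two preceding ones with
  coefficients that are bounded for \<open>s \<ge> 1\<close>, so boundedness of the first two suffices.
\<close>

lemma cos_sqrt_deriv_bounded_ge_1: "\<exists>M. \<forall>s\<ge>1. \<bar>cos_sqrt_deriv t n s\<bar> \<le> M"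
proof (induction n rule: induct_nat_012)
  case 0
  have "\<bar>cos_sqrt_deriv t 0 s\<bar> \<le> 1" if "s \<ge> 1" for s
    using that by (simp add: cos_sqrt_deriv_0)
  then show ?case by blast
next
  case 1
  have "\<bar>cos_sqrt_deriv t (Suc 0) s\<bar> \<le> \<bar>t\<bar>" if "s \<ge> 1" for s
  proof -
    have "\<bar>t\<bar> * \<bar>sin (t * sqrt s)\<bar> \<le> \<bar>t\<bar> * (2 * sqrt s)"
    proof (intro mult_left_mono order_trans[OF abs_sin_le_one] abs_ge_zero)
      have "1 \<le> sqrt s" using that by simp
      then show "1 \<le> 2 * sqrt s" by linarith
    qed
    moreover have "sqrt s > 0" using that by simp
    ultimately have "\<bar>t\<bar> * \<bar>sin (t * sqrt s)\<bar> / (2 * sqrt s) \<le> \<bar>t\<bar>"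
      by (simp add: divide_le_eq)
    then show ?thesis using that cos_sqrt_deriv_1[of s t] by (simp add: abs_mult abs_divide)
  qed
  then show ?case by blast
next
  case (ge2 n)
  let ?Y = "cos_sqrt_deriv t"
  obtain M0 M1 where M0: "\<And>s. s \<ge> 1 \<Longrightarrow> \<bar>?Y n s\<bar> \<le> M0" and M1: "\<And>s. s \<ge> 1 \<Longrightarrow> \<bar>?Y (Suc n) s\<bar> \<le> M1"
    using ge2 by blast
  have "\<bar>?Y (Suc (Suc n)) s\<bar> \<le> (4 * real n + 2) * M1 + t\<^sup>2 * M0" if s: "s \<ge> 1" for s
  proof -
    have "1 * \<bar>?Y (Suc (Suc n)) s\<bar> \<le> (4 * s) * \<bar>?Y (Suc (Suc n)) s\<bar>"
      using s by (intro mult_right_mono) auto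
    also have "\<dots> = \<bar>4 * s * ?Y (Suc (Suc n)) s\<bar>" using s by (simp add: abs_mult)
    also have "\<dots> = \<bar>(4 * real n + 2) * ?Y (Suc n) s + t\<^sup>2 * ?Y n s\<bar>"
      using cos_sqrt_deriv_ode[of s t n] s by linarith
    also have "\<dots> \<le> (4 * real n + 2) * \<bar>?Y (Suc n) s\<bar> + t\<^sup>2 * \<bar>?Y n s\<bar>"
      by (rule order_trans[OF abs_triangle_ineq]) (simp add: abs_mult)
    also have "\<dots> \<le> (4 * real n + 2) * M1 + t\<^sup>2 * M0"
      using M0[OF s] M1[OF s] by (intro add_mono mult_left_mono) auto
    finally show ?thesis by simp
  qed
  then show ?case by blast
qed

lemma cos_sqrt_deriv_bounded:
  obtains M where "\<And>s. s \<ge> 0 \<Longrightarrow> \<bar>cos_sqrt_deriv t n s\<bar> \<le> M"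
proof -
  obtain M1 where M1: "\<And>s. s \<ge> 1 \<Longrightarrow> \<bar>cos_sqrt_deriv t n s\<bar> \<le> M1"
    using cos_sqrt_deriv_bounded_ge_1 by blast
  have "compact (cos_sqrt_deriv t n ` {0..1})"
    by (rule compact_continuous_image[OF DERIV_continuous_on[OF
            has_field_derivative_at_within[OF cos_sqrt_deriv_has_real_derivative]] compact_Icc])
  then obtain M0 where "\<forall>y\<in>cos_sqrt_deriv t n ` {0..1}. norm y \<le> M0"
    using compact_imp_bounded bounded_iff by blast
  then have M0: "\<bar>cos_sqrt_deriv t n s\<bar> \<le> M0" if "s \<ge> 0" "s \<le> 1" for s
    using that by auto
  have "\<bar>cos_sqrt_deriv t n s\<bar> \<le> max M0 M1" if "s \<ge> 0" for s
    using M0[of s] M1[of s] that by (cases "s \<le> 1") auto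
  with that show thesis by blast
qed

section \<open>The dispersion relation\<close>

text \<open>
  The cut-off is part of the kernel so that integrals over \<open>{-1..1}\<close> become integrals over the line.
\<close>

definition fractional_kernel :: "real \<Rightarrow> real \<Rightarrow> real" where
  "fractional_kernel \<alpha> z = indicator {-1..1} z / \<bar>z\<bar> powr (1 + 2 * \<alpha>)"

lemma fractional_kernel_nonneg: "fractional_kernel \<alpha> z \<ge> 0"
  by (simp add: fractional_kernel_def)

lemma fractional_kernel_eq_0: "\<not> \<bar>z\<bar> \<le> 1 \<Longrightarrow> fractional_kernel \<alpha> z = 0"
  by (auto simp: fractional_kernel_def indicator_def)

lemma fractional_kernel_measurable: "fractional_kernel \<alpha> \<in> borel_measurable borel"
  unfolding fractional_kernel_def by measurable

lemma integrable_powr_symmetric: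
  fixes \<beta> :: real
  assumes "\<beta> > -1"
  shows "integrable lborel (\<lambda>z. indicator {-1..1} z * \<bar>z\<bar> powr \<beta>)"
proof -
  let ?h = "\<lambda>z::real. indicator {0..1} z * z powr \<beta>"
  have "(\<lambda>z. z powr \<beta>) absolutely_integrable_on {0..1}"
    using assms by (intro nonnegative_absolutely_integrable_1 integrable_on_powr_from_0) auto
  then have "integrable lebesgue ?h"
    by (simp add: set_integrable_def)
  then have h: "integrable lborel ?h"
    by (subst (asm) integrable_completion) auto
  have "indicator {-1..1} z * \<bar>z\<bar> powr \<beta> = ?h z + ?h (0 + -1 * z)" for z
    by (auto simp: indicator_def)
  then show ?thesis
    using Bochner_Integration.integrable_add[OF h lborel_integrable_real_affine[OF h, of "-1" 0]] by simp
qed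

text \<open>
  For \<open>\<alpha> \<ge> 0\<close> the kernel itself is not integrable at \<open>0\<close>; its second moment is finite because
  \<open>1 - 2 * \<alpha> > -1\<close>.
\<close>

lemma integrable_fractional_kernel_square:
  assumes "\<alpha> < 1"
  shows "integrable lborel (\<lambda>z. fractional_kernel \<alpha> z * z\<^sup>2)"
proof -
  have "fractional_kernel \<alpha> z * z\<^sup>2 = indicator {-1..1} z * \<bar>z\<bar> powr (1 - 2 * \<alpha>)" for z
  proof (cases "z = 0")
    case False
    have "\<bar>z\<bar> powr (2 - (1 + 2 * \<alpha>)) = \<bar>z\<bar> powr 2 / \<bar>z\<bar> powr (1 + 2 * \<alpha>)"
      by (rule powr_diff)
    then have "\<bar>z\<bar> powr (1 - 2 * \<alpha>) = z\<^sup>2 / \<bar>z\<bar> powr (1 + 2 * \<alpha>)"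
      using False by (simp add: powr_numeral)
    then show ?thesis by (simp add: fractional_kernel_def)
  qed simp
  then show ?thesis using integrable_powr_symmetric[of "1 - 2 * \<alpha>"] assms by simp
qed

text \<open>
  For \<open>n = 0\<close> this is the kernel times \<open>1 + \<i> * \<theta> - iexp \<theta>\<close> with \<open>\<theta> = \<xi> * d * z\<close>, whose real part is
  \<open>1 - cos \<theta>\<close>; for larger \<open>n\<close> it is the \<open>n\<close>-th derivative in \<open>\<xi>\<close>. The term \<open>\<i> * \<theta>\<close> makes the integrand
  \<open>O(\<theta>\<^sup>2)\<close>, which the singularity of the kernel requires. Compared with \<open>1 - cos \<theta>\<close>, whose
  derivatives alternate between sines and cosines, the exponential gives one formula for all
  \<open>n\<close>.
\<close>

definition symbol_integrand :: "real \<Rightarrow> real \<Rightarrow> nat \<Rightarrow> real \<Rightarrow> real \<Rightarrow> complex" where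
  "symbol_integrand \<alpha> d n \<xi> z =
     of_real (fractional_kernel \<alpha> z) * (\<i> * of_real (d * z)) ^ n *
       ((if n = 0 then 1 + \<i> * of_real (\<xi> * d * z) else if n = 1 then 1 else 0) - iexp (\<xi> * d * z))"

lemma symbol_integrand_measurable: "symbol_integrand \<alpha> d n \<xi> \<in> borel_measurable borel"
  using fractional_kernel_measurable[measurable] unfolding symbol_integrand_def by measurable

text \<open>
  In every case two factors of \<open>z\<close> are available to tame the kernel: \<open>2 - n\<close> of them come from
  the Taylor remainder of the exponential when \<open>n \<le> 2\<close>, and the rest from \<open>(\<i> * d * z) ^ n\<close>.
\<close>

lemma symbol_integrand_bound:
  obtains K where "\<And>\<xi> z. norm (symbol_integrand \<alpha> d n \<xi> z) \<le> K * (1 + \<bar>\<xi>\<bar>)\<^sup>2 * (fractional_kernel \<alpha> z * z\<^sup>2)"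
proof -
  consider "n = 0" | "n = 1" | m where "n = Suc (Suc m)"
    by (cases n rule: nat.exhaust; cases "n - 1") auto
  then have "\<exists>K. \<forall>\<xi> z. norm (symbol_integrand \<alpha> d n \<xi> z) \<le> K * (1 + \<bar>\<xi>\<bar>)\<^sup>2 * (fractional_kernel \<alpha> z * z\<^sup>2)"
  proof cases
    case 1
    have "norm (symbol_integrand \<alpha> d n \<xi> z) \<le> d\<^sup>2 * (1 + \<bar>\<xi>\<bar>)\<^sup>2 * (fractional_kernel \<alpha> z * z\<^sup>2)" for \<xi> z
    proof -
      have "symbol_integrand \<alpha> d n \<xi> z
          = - (of_real (fractional_kernel \<alpha> z) * (iexp (\<xi> * d * z) - 1 - \<i> * (\<xi> * d * z)))"
        using 1 by (simp add: symbol_integrand_def algebra_simps)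
      then have "norm (symbol_integrand \<alpha> d n \<xi> z)
          = fractional_kernel \<alpha> z * norm (iexp (\<xi> * d * z) - 1 - \<i> * (\<xi> * d * z))"
        by (simp only: norm_minus_cancel norm_mult norm_of_real abs_of_nonneg[OF fractional_kernel_nonneg])
      also have "\<dots> \<le> fractional_kernel \<alpha> z * ((1 + \<bar>\<xi>\<bar>)\<^sup>2 * (d * z)\<^sup>2)"
      proof (intro mult_left_mono fractional_kernel_nonneg order_trans[OF norm_iexp_remainder(2)])
        have "(\<xi> * d * z)\<^sup>2 / 2 \<le> \<bar>\<xi>\<bar>\<^sup>2 * (d * z)\<^sup>2" by (simp add: power_mult_distrib)
        also have "\<dots> \<le> (1 + \<bar>\<xi>\<bar>)\<^sup>2 * (d * z)\<^sup>2" by (intro mult_right_mono power_mono) auto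
        finally show "(\<xi> * d * z)\<^sup>2 / 2 \<le> (1 + \<bar>\<xi>\<bar>)\<^sup>2 * (d * z)\<^sup>2" .
      qed
      finally show ?thesis by (simp add: power_mult_distrib mult_ac)
    qed
    then show ?thesis by blast
  next
    case 2
    have "norm (symbol_integrand \<alpha> d n \<xi> z) \<le> d\<^sup>2 * (1 + \<bar>\<xi>\<bar>)\<^sup>2 * (fractional_kernel \<alpha> z * z\<^sup>2)" for \<xi> z
    proof -
      have "norm (symbol_integrand \<alpha> d n \<xi> z)
          = fractional_kernel \<alpha> z * (\<bar>d * z\<bar> * norm (iexp (\<xi> * d * z) - 1))"
        using 2 fractional_kernel_nonneg[of \<alpha> z]
        by (simp add: symbol_integrand_def norm_mult norm_minus_commute abs_mult)
      also have "\<dots> \<le> fractional_kernel \<alpha> z * (\<bar>d * z\<bar> * \<bar>\<xi> * d * z\<bar>)"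
        by (intro mult_left_mono fractional_kernel_nonneg norm_iexp_remainder(1)) auto
      also have "\<dots> = fractional_kernel \<alpha> z * (\<bar>\<xi>\<bar> * (d * z)\<^sup>2)"
        by (simp add: abs_mult power2_eq_square mult_ac)
      also have "\<dots> \<le> fractional_kernel \<alpha> z * ((1 + \<bar>\<xi>\<bar>)\<^sup>2 * (d * z)\<^sup>2)"
      proof (intro mult_left_mono mult_right_mono fractional_kernel_nonneg)
        show "\<bar>\<xi>\<bar> \<le> (1 + \<bar>\<xi>\<bar>)\<^sup>2"
          by (simp add: power2_eq_square algebra_simps add_nonneg_nonneg)
      qed auto
      finally show ?thesis by (simp add: power_mult_distrib mult_ac)
    qed
    then show ?thesis by blast
  next
    case (3 m)
    have "norm (symbol_integrand \<alpha> d n \<xi> z) \<le> \<bar>d\<bar> ^ n * (1 + \<bar>\<xi>\<bar>)\<^sup>2 * (fractional_kernel \<alpha> z * z\<^sup>2)" for \<xi> z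
    proof (cases "\<bar>z\<bar> \<le> 1")
      case True
      have "norm (symbol_integrand \<alpha> d n \<xi> z) = \<bar>d\<bar> ^ n * 1 * (fractional_kernel \<alpha> z * \<bar>z\<bar> ^ n)"
        using 3 fractional_kernel_nonneg[of \<alpha> z]
        by (simp add: symbol_integrand_def norm_mult norm_power abs_mult power_mult_distrib)
      also have "\<dots> \<le> \<bar>d\<bar> ^ n * (1 + \<bar>\<xi>\<bar>)\<^sup>2 * (fractional_kernel \<alpha> z * \<bar>z\<bar> ^ 2)"
        using True 3 by (intro mult_mono mult_left_mono power_decreasing fractional_kernel_nonneg) (auto simp: fractional_kernel_nonneg)
      finally show ?thesis by simp
    qed (simp add: symbol_integrand_def fractional_kernel_eq_0)
    then show ?thesis by blast
  qed
  with that show thesis by blast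
qed

lemma symbol_integrand_integrable:
  assumes "\<alpha> < 1"
  shows "integrable lborel (symbol_integrand \<alpha> d n \<xi>)"
proof -
  obtain K where K: "\<And>\<xi> z. norm (symbol_integrand \<alpha> d n \<xi> z) \<le> K * (1 + \<bar>\<xi>\<bar>)\<^sup>2 * (fractional_kernel \<alpha> z * z\<^sup>2)"
    by (rule symbol_integrand_bound) (rule that)
  show ?thesis
  proof (rule Bochner_Integration.integrable_bound)
    show "integrable lborel (\<lambda>z. K * (1 + \<bar>\<xi>\<bar>)\<^sup>2 * (fractional_kernel \<alpha> z * z\<^sup>2))"
      by (intro integrable_mult_right integrable_fractional_kernel_square assms)
    show "AE z in lborel. norm (symbol_integrand \<alpha> d n \<xi> z) \<le> norm (K * (1 + \<bar>\<xi>\<bar>)\<^sup>2 * (fractional_kernel \<alpha> z * z\<^sup>2))"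
      using order_trans[OF K abs_ge_self] by simp
  qed (simp add: symbol_integrand_measurable)
qed

text \<open>
  For every \<open>n\<close> the polynomial parts cancel, and the first-order remainder is the integrand's
  prefactor times \<open>iexp (h * d * z) - 1 - \<i> * (h * d * z)\<close>, hence quadratic in \<open>h * d * z\<close>.
\<close>

lemma symbol_integrand_has_vector_derivative:
  assumes "\<alpha> < 1"
  shows "((\<lambda>\<xi>. LBINT z. symbol_integrand \<alpha> d n \<xi> z) has_vector_derivative
    (LBINT z. symbol_integrand \<alpha> d (Suc n) \<xi> z)) (at \<xi>)"
proof (rule integral_has_vector_derivative_quadratic_remainder[where
      A = "symbol_integrand \<alpha> d n" and A' = "symbol_integrand \<alpha> d (Suc n)" and
      b = "\<lambda>z. \<bar>d\<bar> ^ n * d\<^sup>2 * (fractional_kernel \<alpha> z * z\<^sup>2)"])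
  show "integrable lborel (\<lambda>z. \<bar>d\<bar> ^ n * d\<^sup>2 * (fractional_kernel \<alpha> z * z\<^sup>2))"
    by (intro integrable_mult_right integrable_fractional_kernel_square assms)
  fix \<xi> h z
  show "norm (symbol_integrand \<alpha> d n (\<xi> + h) z - symbol_integrand \<alpha> d n \<xi> z
      - h *\<^sub>R symbol_integrand \<alpha> d (Suc n) \<xi> z) \<le> h\<^sup>2 * (\<bar>d\<bar> ^ n * d\<^sup>2 * (fractional_kernel \<alpha> z * z\<^sup>2))"
  proof (cases "\<bar>z\<bar> \<le> 1")
    case True
    have "symbol_integrand \<alpha> d n (\<xi> + h) z - symbol_integrand \<alpha> d n \<xi> z
        - h *\<^sub>R symbol_integrand \<alpha> d (Suc n) \<xi> z
      = - (of_real (fractional_kernel \<alpha> z) * (\<i> * of_real (d * z)) ^ n * iexp (\<xi> * d * z)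
          * (iexp (h * d * z) - 1 - \<i> * (h * d * z)))"
      by (simp add: symbol_integrand_def scaleR_conv_of_real algebra_simps exp_add)
    also have "norm \<dots> = fractional_kernel \<alpha> z * (\<bar>d\<bar> ^ n * \<bar>z\<bar> ^ n) * norm (iexp (h * d * z) - 1 - \<i> * (h * d * z))"
      using fractional_kernel_nonneg[of \<alpha> z]
      by (simp add: norm_mult norm_power abs_mult power_mult_distrib)
    also have "\<dots> \<le> fractional_kernel \<alpha> z * (\<bar>d\<bar> ^ n * 1) * (h * d * z)\<^sup>2"
    proof (intro mult_mono mult_left_mono fractional_kernel_nonneg)
      show "norm (iexp (h * d * z) - 1 - \<i> * (h * d * z)) \<le> (h * d * z)\<^sup>2"
        by (rule order_trans[OF norm_iexp_remainder(2)]) simp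
      show "\<bar>z\<bar> ^ n \<le> 1" using True by (simp add: power_le_one)
    qed (auto simp: fractional_kernel_nonneg)
    finally show ?thesis by (simp add: power_mult_distrib mult_ac)
  qed (simp add: symbol_integrand_def fractional_kernel_eq_0)
qed (use symbol_integrand_integrable[OF assms] in auto)

lemma symbol_poly_growth:
  assumes "\<alpha> < 1"
  shows "derivs_in poly_growth k (\<lambda>\<xi>. LBINT z. symbol_integrand \<alpha> d n \<xi> z)"
proof -
  have growth: "poly_growth (\<lambda>\<xi>. LBINT z. symbol_integrand \<alpha> d n \<xi> z)" for n
  proof -
    obtain K where K: "\<And>\<xi> z. norm (symbol_integrand \<alpha> d n \<xi> z) \<le> K * (1 + \<bar>\<xi>\<bar>)\<^sup>2 * (fractional_kernel \<alpha> z * z\<^sup>2)"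
      by (rule symbol_integrand_bound) (rule that)
    have "norm (LBINT z. symbol_integrand \<alpha> d n \<xi> z)
        \<le> (K * (LBINT z. fractional_kernel \<alpha> z * z\<^sup>2)) * (1 + \<bar>\<xi>\<bar>) ^ 2" for \<xi>
    proof -
      have "norm (LBINT z. symbol_integrand \<alpha> d n \<xi> z) \<le> (LBINT z. norm (symbol_integrand \<alpha> d n \<xi> z))"
        by (rule integral_norm_bound)
      also have "\<dots> \<le> (LBINT z. K * (1 + \<bar>\<xi>\<bar>)\<^sup>2 * (fractional_kernel \<alpha> z * z\<^sup>2))"
        by (intro integral_mono integrable_norm symbol_integrand_integrable integrable_mult_right
            integrable_fractional_kernel_square assms K)
      also have "\<dots> = K * (1 + \<bar>\<xi>\<bar>)\<^sup>2 * (LBINT z. fractional_kernel \<alpha> z * z\<^sup>2)"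
        by (rule integral_mult_right_zero)
      finally show ?thesis by (simp add: mult_ac)
    qed
    then show ?thesis unfolding poly_growth_def by blast
  qed
  show ?thesis
  proof (induction k arbitrary: n)
    case 0
    then show ?case using growth by simp
  next
    case (Suc k)
    show ?case
      by (rule derivs_in_SucI[OF growth symbol_integrand_has_vector_derivative[OF assms] Suc])
  qed
qed

lemma Re_symbol_integrand_0:
  "Re (symbol_integrand \<alpha> d 0 \<xi> z) = indicator {-1..1} z * ((1 - cos (\<xi> * d * z)) / \<bar>z\<bar> powr (1 + 2 * \<alpha>))"
  by (simp add: symbol_integrand_def fractional_kernel_def Re_exp)

lemma Re_symbol_eq:
  assumes "\<alpha> < 1"
  shows "Re (LBINT z. symbol_integrand \<alpha> d 0 \<xi> z)
    = (LBINT z:{-1..1}. (1 - cos (\<xi> * d * z)) / \<bar>z\<bar> powr (1 + 2 * \<alpha>))"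
  using integral_Re[OF symbol_integrand_integrable[OF assms, of d 0 \<xi>]]
  by (simp add: Re_symbol_integrand_0 set_lebesgue_integral_def)

lemma Re_symbol_integrand_0_nonneg: "Re (symbol_integrand \<alpha> d 0 \<xi> z) \<ge> 0"
  unfolding Re_symbol_integrand_0 by simp

lemma Re_symbol_nonneg:
  assumes "\<alpha> < 1"
  shows "Re (LBINT z. symbol_integrand \<alpha> d 0 \<xi> z) \<ge> 0"
  unfolding integral_Re[OF symbol_integrand_integrable[OF assms], symmetric]
  by (rule Bochner_Integration.integral_nonneg) (rule Re_symbol_integrand_0_nonneg)

text \<open>
  The integrand is nonnegative and strictly positive while \<open>0 < \<bar>\<xi> * d * z\<bar> < pi\<close>, so \<open>\<omega>\<close> vanishes
  only at \<open>\<xi> = 0\<close>. This is what makes the quotient \<open>sin (\<omega> * t) / \<omega>\<close> a genuine quotient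
  everywhere else.
\<close>

lemma Re_symbol_pos:
  assumes "\<alpha> < 1" "d > 0" "\<xi> \<noteq> 0"
  shows "Re (LBINT z. symbol_integrand \<alpha> d 0 \<xi> z) > 0"
proof (rule ccontr)
  let ?f = "\<lambda>z. Re (symbol_integrand \<alpha> d 0 \<xi> z)"
  note int = symbol_integrand_integrable[OF assms(1), of d 0 \<xi>]
  assume "\<not> ?thesis"
  then have "(LBINT z. ?f z) = 0"
    using Re_symbol_nonneg[OF assms(1), of d \<xi>] integral_Re[OF int] by simp
  then have ae: "AE z in lborel. ?f z = 0"
    using integral_nonneg_eq_0_iff_AE[of lborel ?f] integrable_Re[OF int] Re_symbol_integrand_0_nonneg
    by simp
  \<comment> \<open>On \<open>0 < z < r\<close> the point lies in the support of the kernel and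
    \<open>\<bar>\<xi> * d * z\<bar>\<close> stays below \<open>pi\<close>, where the cosine is less than \<open>1\<close>.\<close>
  define r where "r = min 1 (pi / (\<bar>\<xi>\<bar> * d))"
  have "r > 0" using assms by (simp add: r_def)
  have pos: "?f z > 0" if "0 < z" "z < r" for z
  proof -
    have "\<bar>\<xi> * d * z\<bar> < pi"
      using that assms by (simp add: r_def abs_mult field_simps)
    moreover have "\<xi> * d * z \<noteq> 0" using that assms by simp
    ultimately have "cos \<bar>\<xi> * d * z\<bar> < cos 0"
      by (intro cos_monotone_0_pi) auto
    then show ?thesis using that by (simp add: Re_symbol_integrand_0 r_def)
  qed
  have "AE z in lborel. z \<notin> {0<..<r}"
    using ae by eventually_elim (use pos in force)
  then have "emeasure lborel {0<..<r} = 0"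
    by (subst (asm) AE_iff_measurable[where N = "{0<..<r}"]) auto
  then show False using \<open>r > 0\<close> by simp
qed

section \<open>The solution of the peridynamic wave equation\<close>

theorem theorem3p1:
  fixes \<rho> \<kappa> \<delta> \<alpha> t :: real and v\<^sub>0 v\<^sub>1 :: "real \<Rightarrow> complex"
  assumes "\<rho> > 0" and "\<kappa> > 0" and "\<delta> > 0"
    and "0 < \<alpha>" and "\<alpha> < 1"
    and "v\<^sub>0 \<in> schwartz_space" and "v\<^sub>1 \<in> schwartz_space"
    and "t \<ge> 0"
  shows "(\<lambda>x. solution_u \<rho> \<kappa> \<delta> \<alpha> v\<^sub>0 v\<^sub>1 t x) \<in> schwartz_space"
proof -
  define c where "c = 2 * \<kappa> / (\<rho> * \<delta> powr (2 * \<alpha>))"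
  define w where "w \<xi> = c * Re (LBINT z. symbol_integrand \<alpha> \<delta> 0 \<xi> z)" for \<xi>
  have c: "c > 0" using assms by (simp add: c_def)
  have omega: "omega \<rho> \<kappa> \<delta> \<alpha> \<xi> = sqrt (w \<xi>)" for \<xi>
    using assms by (simp add: omega_def w_def c_def Re_symbol_eq)
  have w_nonneg: "w \<xi> \<ge> 0" for \<xi>
    using c Re_symbol_nonneg[OF \<open>\<alpha> < 1\<close>] by (simp add: w_def)
  have w_pos: "w \<xi> > 0" if "\<xi> \<noteq> 0" for \<xi>
    using c Re_symbol_pos[OF \<open>\<alpha> < 1\<close> \<open>\<delta> > 0\<close> that] by (simp add: w_def)
  have w_0: "w 0 = 0"
    using Re_symbol_eq[OF \<open>\<alpha> < 1\<close>, of \<delta> 0] by (simp add: w_def)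
  have w_growth: "derivs_in poly_growth k w" for k
    unfolding w_def
    by (intro derivs_in_poly_growth_bounded_linear[where L = "\<lambda>z. c * Re z"] symbol_poly_growth
        bounded_linear_const_mult bounded_linear_Re \<open>\<alpha> < 1\<close>)
  obtain M where M: "\<And>n s. s \<ge> 0 \<Longrightarrow> \<bar>cos_sqrt_deriv t n s\<bar> \<le> M n"
  proof -
    have "\<exists>M. \<forall>s\<ge>0. \<bar>cos_sqrt_deriv t n s\<bar> \<le> M" for n
      by (rule cos_sqrt_deriv_bounded[of t n]) blast
    then have "\<forall>n. \<exists>M. \<forall>s\<ge>0. \<bar>cos_sqrt_deriv t n s\<bar> \<le> M" by blast
    from choice[OF this] show thesis using that by blast
  qed
  \<comment> \<open>The constant \<open>b\<close> is \<open>1\<close> for the cosine and \<open>-2 / t\<close> for the sine quotient.\<close>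
  have multiplier: "derivs_in poly_growth k (\<lambda>\<xi>. complex_of_real (b * cos_sqrt_deriv t n (w \<xi>)))" for k n b
  proof (rule derivs_in_poly_growth_bounded_linear[where L = "\<lambda>y. complex_of_real (b * y)"])
    show "bounded_linear (\<lambda>y. complex_of_real (b * y))"
      by (rule bounded_linear_compose[OF bounded_linear_of_real bounded_linear_mult_right])
    show "derivs_in poly_growth k (\<lambda>\<xi>. cos_sqrt_deriv t n (w \<xi>))"
      by (rule derivs_in_poly_growth_compose[where Y = "cos_sqrt_deriv t" and w = w,
            OF cos_sqrt_deriv_has_real_derivative M[OF w_nonneg] w_growth])
  qed
  have cos_eq: "cos (omega \<rho> \<kappa> \<delta> \<alpha> \<xi> * t) = 1 * cos_sqrt_deriv t 0 (w \<xi>)" for \<xi>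
    using cos_sqrt_deriv_0[OF w_nonneg, of t \<xi>] by (simp add: omega mult.commute)
  \<comment> \<open>The sine quotient is, up to a constant, the first derivative of \<open>cos (t * sqrt s)\<close> at \<open>s = \<omega>\<^sup>2\<close>.
    For \<open>t = 0\<close> both sides vanish, because \<open>-2 / 0 = 0\<close>.\<close>
  have sin_eq: "sin_quotient \<rho> \<kappa> \<delta> \<alpha> t \<xi> = (- 2 / t) * cos_sqrt_deriv t 1 (w \<xi>)" for \<xi>
  proof (cases "\<xi> = 0")
    case True
    then show ?thesis
      using cos_sqrt_deriv_1_0[of t] by (simp add: sin_quotient_def w_0 power2_eq_square)
  next
    case False
    then show ?thesis
      using cos_sqrt_deriv_1[OF w_pos[OF False], of t] by (simp add: sin_quotient_def omega mult.commute)
  qed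
  have fourier: "fourier_transform v \<in> schwartz_space" if "v \<in> schwartz_space" for v
  proof -
    have "fourier_transform v = (\<lambda>\<xi>. 1 / (2 * of_real pi) * exp_integral 1 v \<xi>)"
      by (simp add: fun_eq_iff fourier_transform_def exp_integral_def mult.commute)
    then show ?thesis
      using schwartz_space_cmult[OF exp_integral_schwartz_space[OF _ that, of 1], of "1 / (2 * of_real pi)"]
      by simp
  qed
  define g where "g = (\<lambda>\<xi>. fourier_transform v\<^sub>0 \<xi> * of_real (cos (omega \<rho> \<kappa> \<delta> \<alpha> \<xi> * t)) +
      fourier_transform v\<^sub>1 \<xi> * of_real (sin_quotient \<rho> \<kappa> \<delta> \<alpha> t \<xi>))"
  have "g \<in> schwartz_space"
    unfolding g_def cos_eq sin_eq
    using assms by (intro schwartz_space_add schwartz_space_mult[OF fourier multiplier])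
  then have "exp_integral (- 1) g \<in> schwartz_space"
    by (rule exp_integral_schwartz_space[rotated]) simp
  moreover have "exp_integral (- 1) g = (\<lambda>x. solution_u \<rho> \<kappa> \<delta> \<alpha> v\<^sub>0 v\<^sub>1 t x)"
    by (simp add: fun_eq_iff exp_integral_def solution_u_def g_def mult_ac)
  ultimately show ?thesis by simp
qed

end
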